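(* Let $d\ge 2$ and let $0<s<d/2$. Then there exists a Borel set $E\subseteq\mathbb{R}^d$ such that $\dim_{\mathrm H} D(E)<1$ and $\dim_{\mathrm F}^{\theta}E\ge s\theta$ for all $\theta\in[0,1]$.
   Context: $D(E)=\{|x-y|:x,y\in E\}$; $\dim_{\mathrm H}$ is Hausdorff dimension. For a finite Borel measure $\mu$ on $\mathbb{R}^d$, $\widehat\mu(z)=\int e^{-2\pi i z\cdot x}\,d\mu(x)$. For $s\ge 0$ define $$\mathcal{J}_{s,\theta}(\mu)=\left(\int_{\mathbb{R}^d}|\widehat\mu(z)|^{2/\theta}|z|^{s/\theta-d}\,dz\right)^{\theta}\ (\theta\in(0,1]),\qquad \mathcal{J}_{s,0}(\mu)=\sup_{z\in\mathbb{R}^d}|\widehat\mu(z)|^2|z|^s.$$ The Fourier spectrum of $\mu$ at $\theta\in[0,1]$ is $\dim_{\mathrm F}^{\theta}\mu=\sup\{s\ge 0:\mathcal{J}_{s,\theta}(\mu)<\infty\}$ (with $\sup\emptyset=0$). For a Borel set $E\subseteq\mathbb{R}^d$, $\dim_{\mathrm F}^{\theta}E=\sup\{\min\{\dim_{\mathrm F}^{\theta}\mu,d\}:\mu\in\mathcal{M}(E)\}$, where $\mathcal{M}(E)$ is the set of finite, non-zero Borel measures with support contained in $E$. *)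

theory Defs
  imports "HOL-Analysis.Analysis"
begin

section \<open>Hausdorff dimension\<close>

text \<open>
  The size \<open>|U|\<^sup>t\<close> of a covering set, with \<open>|\<emptyset>|\<^sup>t = 0\<close> for all \<open>t\<close> and \<open>|U|\<^sup>0 = 1\<close> for \<open>U \<noteq> \<emptyset>\<close>.
  The case distinction is needed because \<open>0 powr 0 = 0\<close>.
\<close>
definition hausdorff_weight :: "real \<Rightarrow> 'a::metric_space set \<Rightarrow> ennreal" where
  "hausdorff_weight t U =
     (if U = {} then 0 else if t = 0 then 1 else ennreal (diameter U powr t))"

text \<open>
  The covering sets are required to be bounded because \<^const>\<open>diameter\<close> is only meaningful
  for bounded sets. The infimum is \<open>\<infinity>\<close> if there is no such cover.
\<close>
definition hausdorff_premeasure :: "real \<Rightarrow> real \<Rightarrow> 'a::metric_space set \<Rightarrow> ennreal" where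
  "hausdorff_premeasure \<delta> t A =
     (INF U \<in> {U :: nat \<Rightarrow> 'a set. (\<forall>i. bounded (U i) \<and> diameter (U i) \<le> \<delta>) \<and> A \<subseteq> (\<Union>i. U i)}.
        \<Sum>i. hausdorff_weight t (U i))"

definition hausdorff_measure :: "real \<Rightarrow> 'a::metric_space set \<Rightarrow> ennreal" where
  "hausdorff_measure t A = (SUP \<delta> \<in> {0<..}. hausdorff_premeasure \<delta> t A)"

definition hausdorff_dim :: "'a::metric_space set \<Rightarrow> ennreal" where
  "hausdorff_dim A = Inf (ennreal ` {t. 0 \<le> t \<and> hausdorff_measure t A = 0})"

section \<open>Distance set\<close>

definition distance_set :: "'a::metric_space set \<Rightarrow> real set" where
  "distance_set E = {dist x y | x y. x \<in> E \<and> y \<in> E}"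

section \<open>Fourier spectrum\<close>

definition fourier_transform :: "'a::euclidean_space measure \<Rightarrow> 'a \<Rightarrow> complex" where
  "fourier_transform \<mu> z = (LINT x|\<mu>. exp (- (2 * of_real pi * \<i> * of_real (z \<bullet> x))))"

definition measure_support :: "'a::topological_space measure \<Rightarrow> 'a set" where
  "measure_support \<mu> = {x. \<forall>U. open U \<and> x \<in> U \<longrightarrow> emeasure \<mu> U > 0}"

definition measures_on :: "'a::topological_space set \<Rightarrow> 'a measure set" where
  "measures_on E =
     {\<mu>. sets \<mu> = sets borel \<and> finite_measure \<mu> \<and> emeasure \<mu> UNIV \<noteq> 0 \<and> measure_support \<mu> \<subseteq> E}"

definition ennreal_powr :: "ennreal \<Rightarrow> real \<Rightarrow> ennreal" where
  "ennreal_powr x p = (if x = \<infinity> then \<infinity> else ennreal (enn2real x powr p))"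

text \<open>
  Two conventions at \<open>z = 0\<close>: in the integral, \<open>0 powr p = 0\<close> only affects a null set;
  in the supremum, \<open>|0|\<^sup>0\<close> is read as \<open>1\<close>.
\<close>
definition fourier_energy :: "real \<Rightarrow> real \<Rightarrow> 'a::euclidean_space measure \<Rightarrow> ennreal" where
  "fourier_energy s \<theta> \<mu> =
     (if \<theta> = 0 then
        (SUP z. ennreal (norm (fourier_transform \<mu> z) ^ 2 * (if s = 0 then 1 else norm z powr s)))
      else
        ennreal_powr
          (\<integral>\<^sup>+ z. ennreal (norm (fourier_transform \<mu> z) powr (2 / \<theta>)
                        * norm z powr (s / \<theta> - real DIM('a))) \<partial>lborel) \<theta>)"

text \<open>
  The spectrum of a measure may be \<open>\<infinity>\<close>, and \<open>Sup \<emptyset> = 0\<close> holds in \<^typ>\<open>ennreal\<close>.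
\<close>
definition fourier_spectrum_measure :: "real \<Rightarrow> 'a::euclidean_space measure \<Rightarrow> ennreal" where
  "fourier_spectrum_measure \<theta> \<mu> = Sup (ennreal ` {s. 0 \<le> s \<and> fourier_energy s \<theta> \<mu> < \<infinity>})"

definition fourier_spectrum :: "real \<Rightarrow> 'a::euclidean_space set \<Rightarrow> ennreal" where
  "fourier_spectrum \<theta> E =
     (SUP \<mu> \<in> measures_on E. min (fourier_spectrum_measure \<theta> \<mu>) (of_nat DIM('a)))"

end

theory Submission
  imports Defs "HOL-Probability.Infinite_Product_Measure"
begin

text \<open>
  The set \<open>E\<close> consists of the points near the unit cube all of whose
  coordinates lie, for each \<open>n\<close> in a geometric sequence, within \<open>2\<^sup>-\<^sup>m\<close> of the grid \<open>2\<^sup>-\<^sup>n\<int>\<close>, where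
  \<open>m / n\<close> is a fixed ratio \<open>a / b > 2\<close>. Two features make it work.

  Distances in \<open>E\<close> are arithmetically restricted. A difference of two points of \<open>E\<close> is, up to
  an error \<open>O(2\<^sup>-\<^sup>m)\<close>, an integer vector divided by \<open>2\<^sup>n\<close>, so its length is within \<open>O(2\<^sup>-\<^sup>m)\<close> of
  \<open>\<surd>K / 2\<^sup>n\<close> for some integer \<open>0 \<le> K \<le> d 4\<^sup>n\<close>. Hence \<open>O(4\<^sup>n)\<close> intervals of length \<open>O(2\<^sup>-\<^sup>m)\<close> cover
  the distance set, whose dimension is therefore at most \<open>2n / m = 2b / a < 1\<close>
  (\<open>hausdorff_dim_distance_set_grid_set_less_1\<close>).

  On the other hand \<open>E\<close> carries a measure of finite \<open>s\<close>-energy. Draw independent random binary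
  digits for each coordinate, but force the digits in the positions \<open>n, \<dots>, m - 1\<close> to be zero for
  each of the scales. If the scales grow fast enough, the proportion of free digits among the
  first \<open>N\<close> never drops far below \<open>b / a\<close>, and \<open>b / a\<close> can be chosen larger than \<open>s / d\<close> since
  \<open>s / d < 1 / 2\<close>. The modulus of the Fourier transform of a coordinate is a product of cosines,
  one for each free digit. Squared and cut off after the first \<open>N\<close> digits this is a Riesz product
  of period \<open>2\<^sup>N\<close>, and its integral over a period is exactly \<open>2\<close> to the number of forbidden digits
  (\<open>nn_integral_riesz_product\<close>). Summing over dyadic frequency shells gives the energy of a
  coordinate (\<open>digit_char_energy_finite\<close>). The \<open>d\<close>-dimensional energy is bounded by the product of
  these because \<open>|z|\<^sup>s\<^sup>-\<^sup>d\<close> is at most the product of the \<open>|z\<^sub>i|\<close> to the power \<open>s / d - 1\<close>.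

  Finite \<open>s\<close>-energy settles all \<open>\<theta>\<close> at once: for a probability measure \<open>\<mu>\<close> the transform has
  modulus at most \<open>1\<close>, so raising it to the power \<open>2 / \<theta> \<ge> 2\<close> only makes it smaller, while the
  weight in the energy with parameters \<open>s\<theta>\<close> and \<open>\<theta>\<close> is again \<open>|z|\<^sup>s\<^sup>-\<^sup>d\<close>
  (\<open>fourier_spectrum_measure_ge\<close>).
\<close>

section \<open>Series with random binary digits\<close>

definition unit_law :: "real measure" where
  "unit_law = restrict_space lborel {0..<1}"

text \<open>
  For \<open>x \<in> [0,1)\<close> this is digit number \<open>j + 1\<close> after the binary point. The difference of floors
  is chosen over a remainder modulo \<open>2\<close> because it is evidently Borel and because halving the
  argument shifts the digits by mere cancellation.
\<close>
definition binary_digit :: "nat \<Rightarrow> real \<Rightarrow> real" where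
  "binary_digit j x = of_int (\<lfloor>2 ^ Suc j * x\<rfloor> - 2 * \<lfloor>2 ^ j * x\<rfloor>)"

definition digit_sum :: "(nat \<Rightarrow> real) \<Rightarrow> real \<Rightarrow> real" where
  "digit_sum w x = (\<Sum>j. w j * binary_digit j x)"

text \<open>
  The characteristic function, at frequency \<open>2\<pi>z\<close> and with the sign convention of the Fourier
  transform, of the random series with weights \<open>w\<close> and fair coin tosses as digits.
\<close>
definition digit_char :: "(nat \<Rightarrow> real) \<Rightarrow> real \<Rightarrow> complex" where
  "digit_char w z = (LINT x|unit_law. exp (- (2 * of_real pi * \<i> * of_real (z * digit_sum w x))))"

lemma prob_space_unit_law: "prob_space unit_law"
  by (rule prob_spaceI) (simp add: unit_law_def emeasure_restrict_space space_restrict_space)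

lemma space_unit_law [simp]: "space unit_law = {0..<1}"
  by (simp add: unit_law_def space_restrict_space)

lemma measurable_unit_law: "f \<in> borel_measurable borel \<Longrightarrow> f \<in> borel_measurable unit_law"
  unfolding unit_law_def by (intro measurable_restrict_space1) simp

lemma binary_digit_cases: "binary_digit j x = 0 \<or> binary_digit j x = 1"
proof -
  define y where "y = 2 ^ j * x"
  have "2 ^ Suc j * x = 2 * y" by (simp add: y_def)
  then have "binary_digit j x = of_int (\<lfloor>2 * y\<rfloor> - 2 * \<lfloor>y\<rfloor>)"
    unfolding binary_digit_def by (simp add: y_def mult.assoc)
  moreover have "\<lfloor>2 * y\<rfloor> - 2 * \<lfloor>y\<rfloor> = 0 \<or> \<lfloor>2 * y\<rfloor> - 2 * \<lfloor>y\<rfloor> = 1"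
    by linarith
  ultimately show ?thesis by (metis of_int_0 of_int_1)
qed

lemma binary_digit_bounds: "0 \<le> binary_digit j x" "binary_digit j x \<le> 1"
  using binary_digit_cases[of j x] by auto

lemma measurable_binary_digit [measurable]: "binary_digit j \<in> borel_measurable borel"
  unfolding binary_digit_def by measurable

lemma measurable_digit_sum [measurable]: "digit_sum w \<in> borel_measurable borel"
  unfolding digit_sum_def by measurable

lemma summable_digit_sum:
  assumes "summable (\<lambda>j. \<bar>w j\<bar>)"
  shows "summable (\<lambda>j. w j * binary_digit j x)"
proof (rule summable_comparison_test'[OF assms, of 0])
  show "norm (w j * binary_digit j x) \<le> \<bar>w j\<bar>" for j
    using binary_digit_cases[of j x] by auto
qed

text \<open>
  On each half of the unit interval the first digit is constant and the others run through the
  digits of a full unit interval. This is the only form in which independence of the digits is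
  used.
\<close>
lemma digit_sum_halves:
  assumes "summable (\<lambda>j. \<bar>w j\<bar>)" "0 \<le> x" "x < 1"
  shows "digit_sum w (x / 2) = digit_sum (\<lambda>j. w (Suc j)) x"
    and "digit_sum w (1 / 2 + x / 2) = w 0 + digit_sum (\<lambda>j. w (Suc j)) x"
proof -
  have d: "binary_digit 0 (x / 2) = 0" "binary_digit 0 (1 / 2 + x / 2) = 1"
  proof -
    have "\<lfloor>x\<rfloor> = 0" "\<lfloor>x / 2\<rfloor> = 0" "\<lfloor>1 / 2 + x / 2\<rfloor> = 0" "\<lfloor>1 + x\<rfloor> = 1"
      using assms(2,3) by (simp_all add: floor_eq_iff)
    then show "binary_digit 0 (x / 2) = 0" "binary_digit 0 (1 / 2 + x / 2) = 1"
      unfolding binary_digit_def by (simp_all add: distrib_left)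
  qed
  have d1: "binary_digit (Suc j) (x / 2) = binary_digit j x" for j
  proof -
    have "(2::real) ^ Suc (Suc j) * (x / 2) = 2 ^ Suc j * x" "(2::real) ^ Suc j * (x / 2) = 2 ^ j * x"
      by simp_all
    then show ?thesis unfolding binary_digit_def by metis
  qed
  have d2: "binary_digit (Suc j) (1 / 2 + x / 2) = binary_digit j x" for j
  proof -
    have "(2::real) ^ Suc (Suc j) * (1 / 2 + x / 2) = 2 ^ Suc j * x + of_int (2 ^ Suc j)"
      "(2::real) ^ Suc j * (1 / 2 + x / 2) = 2 ^ j * x + of_int (2 ^ j)"
      by (simp_all add: distrib_left mult.assoc)
    then have "\<lfloor>(2::real) ^ Suc (Suc j) * (1 / 2 + x / 2)\<rfloor> = \<lfloor>2 ^ Suc j * x\<rfloor> + 2 ^ Suc j"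
      "\<lfloor>(2::real) ^ Suc j * (1 / 2 + x / 2)\<rfloor> = \<lfloor>2 ^ j * x\<rfloor> + 2 ^ j"
      by (metis floor_add_int)+
    then show ?thesis
      unfolding binary_digit_def by simp
  qed
  have e: "digit_sum w y = w 0 * binary_digit 0 y + (\<Sum>j. w (Suc j) * binary_digit (Suc j) y)" for y
    unfolding digit_sum_def using suminf_split_head[OF summable_digit_sum[OF assms(1), of y]] by simp
  show "digit_sum w (x / 2) = digit_sum (\<lambda>j. w (Suc j)) x"
    unfolding e d d1 by (simp add: digit_sum_def)
  show "digit_sum w (1 / 2 + x / 2) = w 0 + digit_sum (\<lambda>j. w (Suc j)) x"
    unfolding e d d2 by (simp add: digit_sum_def)
qed

lemma integrable_unit_law_bounded:
  fixes g :: "real \<Rightarrow> complex"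
  assumes "g \<in> borel_measurable borel" "\<And>x. norm (g x) \<le> B"
  shows "integrable unit_law g"
proof -
  interpret prob_space unit_law by (rule prob_space_unit_law)
  show ?thesis
    by (rule integrable_const_bound[of _ B]) (use assms measurable_unit_law in auto)
qed

lemma integral_unit_law_halves:
  fixes g :: "real \<Rightarrow> complex"
  assumes g: "g \<in> borel_measurable borel" "\<And>x. norm (g x) \<le> B"
  shows "(LINT x|unit_law. g x) =
    ((LINT x|unit_law. g (x / 2)) + (LINT x|unit_law. g (1 / 2 + x / 2))) / 2"
proof -
  note [measurable] = g(1)
  have int: "integrable lborel (\<lambda>x. indicator {a..<b} x *\<^sub>R g x)" for a b
  proof (rule Bochner_Integration.integrable_bound)
    show "integrable lborel (\<lambda>x. B * indicator {a..<b} x)"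
      by (intro integrable_mult_right integrable_real_indicator) (use emeasure_bounded_finite[of "{a..<b}"] in simp_all)
    show "AE x in lborel. norm (indicator {a..<b} x *\<^sub>R g x) \<le> norm (B * indicator {a..<b} x)"
      using g(2) order_trans[OF norm_ge_zero g(2)] by (auto simp: indicator_def)
  qed measurable
  have "(LINT x|unit_law. g x) = (LINT x|lborel. indicator {0..<1} x *\<^sub>R g x)"
    unfolding unit_law_def by (rule integral_restrict_space) simp
  also have "\<dots> = (LINT x|lborel. indicator {0..<1/2} x *\<^sub>R g x + indicator {1/2..<1} x *\<^sub>R g x)"
    by (rule Bochner_Integration.integral_cong) (auto simp: indicator_def)
  also have "\<dots> = (LINT x|lborel. indicator {0..<1/2} x *\<^sub>R g x)
      + (LINT x|lborel. indicator {1/2..<1} x *\<^sub>R g x)"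
    by (rule Bochner_Integration.integral_add) (rule int)+
  also have "(LINT x|lborel. indicator {0..<1/2} x *\<^sub>R g x)
      = (LINT x|lborel. indicator {0..<1} x *\<^sub>R g (x / 2)) / 2"
  proof -
    have "(\<lambda>x. indicator {0..<1/2} (0 + 1/2 * x) *\<^sub>R g (0 + 1/2 * x)) =
        (\<lambda>x::real. indicator {0..<1} x *\<^sub>R g (x / 2))"
      by (auto simp: indicator_def)
    then show ?thesis
      using lborel_integral_real_affine[of "1/2" "\<lambda>x. indicator {0..<1/2} x *\<^sub>R g x" 0]
      by (simp add: scaleR_conv_of_real)
  qed
  also have "(LINT x|lborel. indicator {1/2..<1} x *\<^sub>R g x)
      = (LINT x|lborel. indicator {0..<1} x *\<^sub>R g (1 / 2 + x / 2)) / 2"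
  proof -
    have "(\<lambda>x. indicator {1/2..<1} (1/2 + 1/2 * x) *\<^sub>R g (1/2 + 1/2 * x)) =
        (\<lambda>x::real. indicator {0..<1} x *\<^sub>R g (1 / 2 + x / 2))"
      by (auto simp: fun_eq_iff indicator_def field_simps)
    then show ?thesis
      using lborel_integral_real_affine[of "1/2" "\<lambda>x. indicator {1/2..<1} x *\<^sub>R g x" "1/2"]
      by (simp add: scaleR_conv_of_real)
  qed
  finally show ?thesis
    unfolding unit_law_def by (simp add: integral_restrict_space add_divide_distrib)
qed

lemma norm_character: "norm (exp (- (2 * of_real pi * \<i> * of_real t))) = 1"
  by simp

text \<open>
  The first digit is independent of the others, so the characteristic function factors.
\<close>
lemma digit_char_split:
  assumes "summable (\<lambda>j. \<bar>w j\<bar>)"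
  shows "digit_char w z =
    (1 + exp (- (2 * of_real pi * \<i> * of_real (z * w 0)))) / 2 * digit_char (\<lambda>j. w (Suc j)) z"
proof -
  define e where "e t = exp (- (2 * of_real pi * \<i> * of_real (z * t)))" for t :: real
  have [measurable]: "e \<in> borel_measurable borel" unfolding e_def by measurable
  have e_add: "e (s + t) = e s * e t" for s t
    unfolding e_def by (simp add: exp_add[symmetric] algebra_simps)
  have ne: "norm (e t) \<le> 1" for t unfolding e_def norm_character by simp
  have "digit_char w z = (LINT x|unit_law. e (digit_sum w x))"
    unfolding digit_char_def e_def ..
  also have "\<dots> = ((LINT x|unit_law. e (digit_sum w (x / 2)))
      + (LINT x|unit_law. e (digit_sum w (1 / 2 + x / 2)))) / 2"
    by (rule integral_unit_law_halves[where B = 1]) (auto simp: ne)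
  also have "(LINT x|unit_law. e (digit_sum w (x / 2)))
      = (LINT x|unit_law. e (digit_sum (\<lambda>j. w (Suc j)) x))"
    by (rule Bochner_Integration.integral_cong) (auto simp: digit_sum_halves[OF assms])
  also have "(LINT x|unit_law. e (digit_sum w (1 / 2 + x / 2)))
      = (LINT x|unit_law. e (w 0) * e (digit_sum (\<lambda>j. w (Suc j)) x))"
    by (rule Bochner_Integration.integral_cong) (auto simp: digit_sum_halves[OF assms] e_add)
  also have "\<dots> = e (w 0) * (LINT x|unit_law. e (digit_sum (\<lambda>j. w (Suc j)) x))"
    by simp
  also have "(LINT x|unit_law. e (digit_sum (\<lambda>j. w (Suc j)) x)) = digit_char (\<lambda>j. w (Suc j)) z"
    unfolding digit_char_def e_def ..
  finally show ?thesis
    unfolding e_def by (simp add: algebra_simps add_divide_distrib)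
qed

text \<open>
  \<open>1 + e\<^sup>-\<^sup>2\<^sup>i\<^sup>h = 2 cos h \<cdot> e\<^sup>-\<^sup>i\<^sup>h\<close> with \<open>h = \<pi>t\<close>.
\<close>
lemma norm_coin_factor:
  "norm ((1 + exp (- (2 * of_real pi * \<i> * of_real t))) / 2) = \<bar>cos (pi * t)\<bar>"
proof -
  define h where "h = exp (\<i> * of_real (pi * t))"
  have c: "2 * of_real (cos (pi * t)) = h + inverse h"
    unfolding h_def cos_of_real[symmetric] cos_exp_eq exp_minus by simp
  have h: "norm h = 1" "h \<noteq> 0" unfolding h_def by simp_all
  have "exp (- (2 * of_real pi * \<i> * of_real t)) = inverse h * inverse h"
    unfolding h_def by (simp add: exp_minus[symmetric] exp_add[symmetric] algebra_simps)
  then have "(1 + exp (- (2 * of_real pi * \<i> * of_real t))) / 2 = inverse h * ((h + inverse h) / 2)"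
    using h by (simp add: algebra_simps)
  also have "\<dots> = inverse h * of_real (cos (pi * t))"
    unfolding c[symmetric] by simp
  finally show ?thesis
    using h by (simp add: norm_mult norm_inverse)
qed

lemma norm_digit_char_le_1: "norm (digit_char w z) \<le> 1"
proof -
  interpret prob_space unit_law by (rule prob_space_unit_law)
  have "norm (digit_char w z)
      \<le> (LINT x|unit_law. norm (exp (- (2 * of_real pi * \<i> * of_real (z * digit_sum w x)))))"
    unfolding digit_char_def by (rule integral_norm_bound)
  also have "\<dots> = 1" unfolding norm_character using prob_space by simp
  finally show ?thesis .
qed

lemma norm_digit_char_le_prod:
  assumes "summable (\<lambda>j. \<bar>w j\<bar>)"
  shows "norm (digit_char w z) \<le> (\<Prod>j<n. \<bar>cos (pi * (z * w j))\<bar>)"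
  using assms
proof (induction n arbitrary: w)
  case 0
  show ?case by (simp add: norm_digit_char_le_1)
next
  case (Suc n)
  have "summable (\<lambda>j. \<bar>w (Suc j)\<bar>)"
    using Suc.prems summable_Suc_iff[of "\<lambda>j. \<bar>w j\<bar>"] by simp
  from Suc.IH[OF this]
  have "\<bar>cos (pi * (z * w 0))\<bar> * norm (digit_char (\<lambda>j. w (Suc j)) z)
      \<le> \<bar>cos (pi * (z * w 0))\<bar> * (\<Prod>j<n. \<bar>cos (pi * (z * w (Suc j)))\<bar>)"
    by (rule mult_left_mono) simp
  then show ?case
    unfolding digit_char_split[OF Suc.prems] norm_mult norm_coin_factor prod.lessThan_Suc_shift .
qed

lemma measurable_digit_char [measurable]: "digit_char w \<in> borel_measurable borel"
proof -
  interpret prob_space unit_law by (rule prob_space_unit_law)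
  have [measurable]: "digit_sum w \<in> borel_measurable unit_law"
    by (rule measurable_unit_law) measurable
  have "(\<lambda>z. LINT x|unit_law. exp (- (2 * of_real pi * \<i> * of_real (z * digit_sum w x)))) \<in> borel_measurable (borel :: real measure)"
    by measurable
  then show ?thesis unfolding digit_char_def[abs_def] .
qed

lemma norm_digit_char_minus: "norm (digit_char w (- z)) = norm (digit_char w z)"
proof -
  have "digit_char w (- z) = cnj (digit_char w z)"
    unfolding digit_char_def
    by (subst Bochner_Integration.integral_cnj[symmetric])
       (rule Bochner_Integration.integral_cong, simp_all add: exp_cnj)
  then show ?thesis by simp
qed

section \<open>Riesz products\<close>

definition gapped_weight :: "nat set \<Rightarrow> nat \<Rightarrow> real" where
  "gapped_weight G j = (if j \<in> G then 0 else 1 / 2 ^ Suc j)"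

text \<open>
  The factors with \<open>j \<in> G\<close> equal \<open>1\<close>, since their weight is \<open>0\<close>.
\<close>
definition riesz_product :: "nat set \<Rightarrow> nat \<Rightarrow> real \<Rightarrow> real" where
  "riesz_product G n z = (\<Prod>j<n. (cos (pi * (z * gapped_weight G j)))\<^sup>2)"

lemma summable_gapped_weight: "summable (\<lambda>j. \<bar>gapped_weight G j\<bar>)"
proof (rule summable_comparison_test'[where N = 0])
  show "summable (\<lambda>j. (1/2) ^ Suc j :: real)"
    by (simp add: summable_geometric)
  show "norm \<bar>gapped_weight G j\<bar> \<le> (1/2) ^ Suc j" for j
    by (simp add: gapped_weight_def power_divide)
qed

lemma riesz_product_nonneg: "0 \<le> riesz_product G n z"
  unfolding riesz_product_def by (intro prod_nonneg) simp

lemma measurable_riesz_product [measurable]: "riesz_product G n \<in> borel_measurable borel"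
  unfolding riesz_product_def by measurable

lemma norm_digit_char_le_riesz_product:
  "(norm (digit_char (gapped_weight G) z))\<^sup>2 \<le> riesz_product G n z"
  using power_mono[OF norm_digit_char_le_prod[OF summable_gapped_weight, of G z n] norm_ge_zero, of 2]
  by (simp add: riesz_product_def prod_power_distrib)

lemma riesz_product_periodic: "riesz_product G n (z + 2 ^ n) = riesz_product G n z"
  unfolding riesz_product_def
proof (rule prod.cong)
  fix j assume "j \<in> {..<n}"
  then obtain m where m: "n = Suc j + m" by (metis add_Suc less_imp_Suc_add lessThan_iff)
  show "(cos (pi * ((z + 2 ^ n) * gapped_weight G j)))\<^sup>2 = (cos (pi * (z * gapped_weight G j)))\<^sup>2"
  proof (cases "j \<in> G")
    case False
    have "pi * ((z + 2 ^ n) * gapped_weight G j) = pi * (z * gapped_weight G j) + real (2 ^ m) * pi"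
      using False unfolding gapped_weight_def m by (simp add: field_simps power_add)
    then show ?thesis
      by (simp add: cos_add power_mult_distrib cos_npi power_even_eq[symmetric] flip: power_mult del: of_nat_power)
  qed (simp add: gapped_weight_def)
qed simp

text \<open>
  Translation by half a period, \<open>2\<^sup>n\<close>, leaves the first \<open>n\<close> factors unchanged and turns the last
  cosine, if it is present, into a sine. The two values of the last factor then add up to \<open>1\<close>, and
  to \<open>2\<close> if digit \<open>n\<close> is forbidden. So doubling the interval doubles the integral at
  forbidden digits and preserves it at free ones.
\<close>
lemma nn_integral_riesz_product:
  "(\<integral>\<^sup>+z. ennreal (riesz_product G n z) * indicator {0..<2 ^ n} z \<partial>lborel) = 2 ^ card (G \<inter> {..<n})"
proof (induction n)
  case 0
  have "(\<lambda>z. ennreal (riesz_product G 0 z) * indicator {0..<2 ^ 0} z) = (indicator {0..<1::real} :: real \<Rightarrow> ennreal)"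
    by (auto simp: riesz_product_def)
  then show ?case by (simp add: one_ennreal_def)
next
  case (Suc n)
  let ?R = "\<lambda>n z. ennreal (riesz_product G n z)"
  let ?c = "\<lambda>z. (cos (pi * (z * gapped_weight G n)))\<^sup>2"
  define q :: real where "q = (if n \<in> G then 2 else 1)"
  have step: "riesz_product G (Suc n) z = riesz_product G n z * ?c z" for z
    by (simp add: riesz_product_def)
  have pair: "?c z + ?c (2 ^ n + z) = q" for z
  proof (cases "n \<in> G")
    case False
    have "pi * ((2 ^ n + z) * gapped_weight G n) = pi * (z * gapped_weight G n) + pi / 2"
      using False by (simp add: gapped_weight_def field_simps)
    then show ?thesis
      using False by (simp add: cos_add q_def)
  qed (simp add: gapped_weight_def q_def)
  have "(\<integral>\<^sup>+z. ?R (Suc n) z * indicator {0..<2 ^ Suc n} z \<partial>lborel)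
      = (\<integral>\<^sup>+z. ?R (Suc n) z * indicator {0..<2 ^ n} z
          + ?R (Suc n) z * indicator {2 ^ n..<2 ^ Suc n} z \<partial>lborel)"
  proof (rule nn_integral_cong)
    fix z :: real
    have "(2::real) ^ n \<ge> 0" by simp
    then show "?R (Suc n) z * indicator {0..<2 ^ Suc n} z = ?R (Suc n) z * indicator {0..<2 ^ n} z
          + ?R (Suc n) z * indicator {2 ^ n..<2 ^ Suc n} z"
      by (auto simp: indicator_def)
  qed
  also have "\<dots> = (\<integral>\<^sup>+z. ?R (Suc n) z * indicator {0..<2 ^ n} z \<partial>lborel)
      + (\<integral>\<^sup>+z. ?R (Suc n) z * indicator {2 ^ n..<2 ^ Suc n} z \<partial>lborel)"
    by (rule nn_integral_add) measurable
  also have "(\<integral>\<^sup>+z. ?R (Suc n) z * indicator {2 ^ n..<2 ^ Suc n} z \<partial>lborel)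
      = (\<integral>\<^sup>+z. ?R (Suc n) (2 ^ n + z) * indicator {0..<2 ^ n} z \<partial>lborel)"
  proof -
    have "(\<integral>\<^sup>+z. ?R (Suc n) z * indicator {2 ^ n..<2 ^ Suc n} z \<partial>lborel)
      = (\<integral>\<^sup>+z. ?R (Suc n) (2 ^ n + z) * indicator {2 ^ n..<2 ^ Suc n} (2 ^ n + z) \<partial>lborel)"
      by (subst nn_integral_real_affine[where t = "2 ^ n" and c = 1]) simp_all
    also have "\<dots> = (\<integral>\<^sup>+z. ?R (Suc n) (2 ^ n + z) * indicator {0..<2 ^ n} z \<partial>lborel)"
      by (rule nn_integral_cong) (auto simp: indicator_def)
    finally show ?thesis .
  qed
  also have "(\<integral>\<^sup>+z. ?R (Suc n) z * indicator {0..<2 ^ n} z \<partial>lborel)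
      + (\<integral>\<^sup>+z. ?R (Suc n) (2 ^ n + z) * indicator {0..<2 ^ n} z \<partial>lborel)
      = (\<integral>\<^sup>+z. ?R (Suc n) z * indicator {0..<2 ^ n} z
          + ?R (Suc n) (2 ^ n + z) * indicator {0..<2 ^ n} z \<partial>lborel)"
    by (rule nn_integral_add[symmetric]) measurable
  also have "\<dots> = (\<integral>\<^sup>+z. ennreal q * (?R n z * indicator {0..<2 ^ n} z) \<partial>lborel)"
  proof (rule nn_integral_cong)
    fix z
    have "riesz_product G (Suc n) z + riesz_product G (Suc n) (2 ^ n + z) = riesz_product G n z * q"
      unfolding step pair[of z, symmetric]
      using riesz_product_periodic[of G n z] by (simp add: algebra_simps)
    then have "?R (Suc n) z + ?R (Suc n) (2 ^ n + z) = ennreal q * ?R n z"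
      by (simp add: riesz_product_nonneg q_def ennreal_plus[symmetric] ennreal_mult'[symmetric] mult.commute
          del: ennreal_plus)
    then show "?R (Suc n) z * indicator {0..<2 ^ n} z + ?R (Suc n) (2 ^ n + z) * indicator {0..<2 ^ n} z
        = ennreal q * (?R n z * indicator {0..<2 ^ n} z)"
      by (simp add: indicator_def)
  qed
  also have "\<dots> = ennreal q * 2 ^ card (G \<inter> {..<n})"
    by (subst nn_integral_cmult) (simp_all add: Suc.IH)
  also have "\<dots> = 2 ^ card (G \<inter> {..<Suc n})"
    by (simp add: q_def lessThan_Suc Int_insert_right)
  finally show ?case .
qed

lemma nn_integral_even_le:
  fixes h :: "real \<Rightarrow> ennreal"
  assumes [measurable]: "h \<in> borel_measurable borel" and even: "\<And>z. h (- z) = h z"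
  shows "(\<integral>\<^sup>+z. h z \<partial>lborel) \<le> 2 * (\<integral>\<^sup>+z. h z * indicator {0..} z \<partial>lborel)"
proof -
  have "(\<integral>\<^sup>+z. h z \<partial>lborel) \<le> (\<integral>\<^sup>+z. h z * indicator {0..} z + h z * indicator {..0} z \<partial>lborel)"
    by (rule nn_integral_mono) (auto simp: indicator_def)
  also have "\<dots> = (\<integral>\<^sup>+z. h z * indicator {0..} z \<partial>lborel) + (\<integral>\<^sup>+z. h z * indicator {..0} z \<partial>lborel)"
    by (rule nn_integral_add) measurable
  also have "(\<integral>\<^sup>+z. h z * indicator {..0} z \<partial>lborel) = (\<integral>\<^sup>+z. h (- z) * indicator {..0} (- z) \<partial>lborel)"
    by (subst nn_integral_real_affine[where t = 0 and c = "-1"]) simp_all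
  also have "\<dots> = (\<integral>\<^sup>+z. h z * indicator {0..} z \<partial>lborel)"
    by (rule nn_integral_cong) (auto simp: even indicator_def)
  finally show ?thesis by (simp add: mult_2)
qed

lemma dyadic_shell:
  fixes z :: real
  assumes "1 \<le> z"
  obtains n :: nat where "2 ^ n \<le> z" "z < 2 ^ Suc n"
proof -
  obtain m where m: "z < 2 ^ m" using real_arch_pow[of 2 z] by auto
  define k where "k = (LEAST m. z < 2 ^ m)"
  have k: "z < 2 ^ k" unfolding k_def by (rule LeastI[of _ m]) (rule m)
  then have "k \<noteq> 0" using assms by (intro notI) simp
  then obtain n where n: "k = Suc n" by (cases k) auto
  have "\<not> z < 2 ^ n" using not_less_Least[of n "\<lambda>m. z < 2 ^ m"] n k_def by simp
  then show ?thesis using that[of n] k n by simp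
qed

text \<open>
  On the shell \<open>2\<^sup>n \<le> z < 2\<^sup>n\<^sup>+\<^sup>1\<close> the weight \<open>z\<^sup>u\<^sup>-\<^sup>1\<close> is at most \<open>2\<^sup>n\<^sup>(\<^sup>u\<^sup>-\<^sup>1\<^sup>)\<close> and the squared
  transform is at most a Riesz product with integral at most \<open>2\<^sup>\<rho>\<^sup>(\<^sup>n\<^sup>+\<^sup>1\<^sup>)\<close>, so the shells
  contribute a geometric series with ratio \<open>2\<^sup>u\<^sup>+\<^sup>\<rho>\<^sup>-\<^sup>1 < 1\<close>. Near the origin the transform is bounded by
  \<open>1\<close> and the weight is integrable because \<open>u > 0\<close>.
\<close>
lemma digit_char_energy_finite:
  assumes gaps: "\<And>n. real (card (G \<inter> {..<n})) \<le> \<rho> * real n"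
    and u: "0 < u" "u + \<rho> < 1"
  shows "(\<integral>\<^sup>+z. ennreal ((norm (digit_char (gapped_weight G) z))\<^sup>2 * \<bar>z\<bar> powr (u - 1)) \<partial>lborel) < \<infinity>"
proof -
  have "u \<le> 1" using gaps[of 1] u by simp
  define h where "h z = (norm (digit_char (gapped_weight G) z))\<^sup>2 * \<bar>z\<bar> powr (u - 1)" for z
  have h_even: "h (- z) = h z" for z
    by (simp add: h_def norm_digit_char_minus)
  have [measurable]: "h \<in> borel_measurable borel" unfolding h_def by measurable
  define c where "c n = 2 powr (real n * (u - 1))" for n :: nat
  have near: "(\<integral>\<^sup>+z. ennreal (z powr (u - 1)) * indicator {0..1} z \<partial>lborel) = ennreal (1 / u)"
    using has_integral_powr_from_0[of "u - 1" 1] u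
    by (intro nn_integral_has_integral_lebesgue') auto
  have shell: "(\<integral>\<^sup>+z. ennreal (c n) * (ennreal (riesz_product G (Suc n) z) * indicator {0..<2 ^ Suc n} z) \<partial>lborel)
      \<le> ennreal (2 powr \<rho> * (2 powr (u + \<rho> - 1)) ^ n)" for n
  proof -
    have "(\<integral>\<^sup>+z. ennreal (c n) * (ennreal (riesz_product G (Suc n) z) * indicator {0..<2 ^ Suc n} z) \<partial>lborel)
        = ennreal (c n) * 2 ^ card (G \<inter> {..<Suc n})"
      by (subst nn_integral_cmult) (measurable, simp only: nn_integral_riesz_product)
    also have "\<dots> = ennreal (c n * 2 powr real (card (G \<inter> {..<Suc n})))"
      by (simp add: c_def powr_realpow ennreal_mult ennreal_power[symmetric])
    also have "\<dots> \<le> ennreal (c n * 2 powr (\<rho> * real (Suc n)))"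
      by (intro ennreal_leI mult_left_mono powr_mono gaps) (simp_all add: c_def)
    also have "c n * 2 powr (\<rho> * real (Suc n)) = 2 powr \<rho> * (2 powr (u + \<rho> - 1)) ^ n"
      unfolding c_def by (simp add: powr_add[symmetric] powr_realpow[symmetric] powr_powr algebra_simps)
    finally show ?thesis .
  qed
  have ptw: "ennreal (h z) * indicator {0..} z \<le> ennreal (z powr (u - 1)) * indicator {0..1} z
      + (\<Sum>n. ennreal (c n) * (ennreal (riesz_product G (Suc n) z) * indicator {0..<2 ^ Suc n} z))" for z
  proof -
    consider "z < 0" | "0 \<le> z" "z \<le> 1" | "1 \<le> z" by linarith
    then show ?thesis
    proof cases
      case 2
      have "h z \<le> 1 * z powr (u - 1)"
        unfolding h_def using 2 norm_digit_char_le_1[of "gapped_weight G" z]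
        by (intro mult_mono) (auto simp: power_le_one)
      then have "ennreal (h z) * indicator {0..} z \<le> ennreal (z powr (u - 1)) * indicator {0..1} z"
        using 2 by (simp add: ennreal_leI)
      then show ?thesis by (rule order_trans) simp
    next
      case 3
      then obtain n where n: "2 ^ n \<le> z" "z < 2 ^ Suc n" by (rule dyadic_shell)
      have "z powr (u - 1) \<le> (2 ^ n) powr (u - 1)"
        using n \<open>u \<le> 1\<close> by (intro powr_mono2') auto
      also have "(2 ^ n) powr (u - 1) = c n"
        by (simp add: c_def powr_powr powr_realpow[symmetric])
      finally have "h z \<le> riesz_product G (Suc n) z * c n"
        unfolding h_def using 3 norm_digit_char_le_riesz_product[of G z "Suc n"]
        by (intro mult_mono) (auto simp: riesz_product_nonneg)
      then have "ennreal (h z) * indicator {0..} z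
          \<le> ennreal (c n) * (ennreal (riesz_product G (Suc n) z) * indicator {0..<2 ^ Suc n} z)"
        using 3 n by (simp add: ennreal_leI ennreal_mult'[symmetric] c_def mult.commute riesz_product_nonneg)
      also have "\<dots> = (\<Sum>n\<in>{n}. ennreal (c n) * (ennreal (riesz_product G (Suc n) z) * indicator {0..<2 ^ Suc n} z))"
        by simp
      also have "\<dots> \<le> (\<Sum>n. ennreal (c n) * (ennreal (riesz_product G (Suc n) z) * indicator {0..<2 ^ Suc n} z))"
        by (rule sum_le_suminf) simp_all
      finally show ?thesis by (rule order_trans) simp
    qed simp
  qed
  have "(\<integral>\<^sup>+z. ennreal (h z) * indicator {0..} z \<partial>lborel)
      \<le> (\<integral>\<^sup>+z. ennreal (z powr (u - 1)) * indicator {0..1} z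
      + (\<Sum>n. ennreal (c n) * (ennreal (riesz_product G (Suc n) z) * indicator {0..<2 ^ Suc n} z)) \<partial>lborel)"
    by (intro nn_integral_mono ptw)
  also have "\<dots> = ennreal (1 / u)
      + (\<Sum>n. \<integral>\<^sup>+z. ennreal (c n) * (ennreal (riesz_product G (Suc n) z) * indicator {0..<2 ^ Suc n} z) \<partial>lborel)"
    by (subst nn_integral_add) (measurable, simp only: near, subst nn_integral_suminf, measurable)
  also have "\<dots> \<le> ennreal (1 / u) + (\<Sum>n. ennreal (2 powr \<rho> * (2 powr (u + \<rho> - 1)) ^ n))"
    by (intro add_left_mono suminf_le shell) simp_all
  also have "\<dots> < \<infinity>"
  proof -
    have "(2::real) powr (u + \<rho> - 1) < 2 powr 0" using u by (intro powr_less_mono) auto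
    then have "summable (\<lambda>n. 2 powr \<rho> * (2 powr (u + \<rho> - 1)) ^ n)"
      by (intro summable_mult summable_geometric) simp
    then show ?thesis
      by (subst suminf_ennreal2) simp_all
  qed
  finally have fin: "(\<integral>\<^sup>+z. ennreal (h z) * indicator {0..} z \<partial>lborel) < \<infinity>" .
  have "(\<integral>\<^sup>+z. ennreal (h z) \<partial>lborel) \<le> 2 * (\<integral>\<^sup>+z. ennreal (h z) * indicator {0..} z \<partial>lborel)"
    by (rule nn_integral_even_le) (simp_all add: h_even)
  also have "\<dots> < \<infinity>" using fin by (simp add: ennreal_mult_less_top)
  finally show ?thesis unfolding h_def .
qed

section \<open>The set and its measure\<close>

definition grid_nbhd :: "nat \<Rightarrow> nat \<Rightarrow> real set" where
  "grid_nbhd n m = (\<Union>k\<in>{..2 ^ n}. {real k / 2 ^ n .. real k / 2 ^ n + 1 / 2 ^ m})"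

definition grid_set :: "(nat \<Rightarrow> nat) \<Rightarrow> (nat \<Rightarrow> nat) \<Rightarrow> 'a::euclidean_space set" where
  "grid_set N L = {x. \<forall>k. \<forall>i\<in>Basis. x \<bullet> i \<in> grid_nbhd (N k) (L k)}"

text \<open>
  The measure is defined as an image of the uniform measure on the cube, rather than as a product
  of one-dimensional image measures, so that every point of the cube, not only almost every one,
  is sent into the set that has to carry the measure.
\<close>
definition gapped_measure :: "nat set \<Rightarrow> 'a::euclidean_space measure" where
  "gapped_measure G = distr (Pi\<^sub>M Basis (\<lambda>_. unit_law)) borel
     (\<lambda>f. \<Sum>i\<in>Basis. digit_sum (gapped_weight G) (f i) *\<^sub>R i)"

lemma closed_grid_set: "closed (grid_set N L :: 'a::euclidean_space set)"
proof -
  have "closed (grid_nbhd n m)" for n m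
    unfolding grid_nbhd_def by (intro closed_UN) auto
  then have c: "closed ((\<lambda>x::'a. x \<bullet> i) -` grid_nbhd n m)" for i n m
    by (intro continuous_closed_vimage) (auto intro!: continuous_intros)
  have "(grid_set N L :: 'a set) = (\<Inter>k. \<Inter>i\<in>Basis. (\<lambda>x. x \<bullet> i) -` grid_nbhd (N k) (L k))"
    unfolding grid_set_def by auto
  then show ?thesis
    using c by (simp add: closed_INT)
qed

lemma gapped_weight_bounds: "0 \<le> gapped_weight G j" "gapped_weight G j \<le> (1/2) ^ Suc j"
  by (simp_all add: gapped_weight_def power_divide)

lemma digit_partial_sum_dyadic:
  "\<exists>k<2 ^ n. (\<Sum>j<n. gapped_weight G j * binary_digit j x) = real k / 2 ^ n"
proof (induction n)
  case (Suc n)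
  then obtain k where k: "k < 2 ^ n"
    "(\<Sum>j<n. gapped_weight G j * binary_digit j x) = real k / 2 ^ n" by blast
  consider "gapped_weight G n * binary_digit n x = 0" | "gapped_weight G n * binary_digit n x = 1 / 2 ^ Suc n"
    using binary_digit_cases[of n x] by (cases "n \<in> G") (auto simp: gapped_weight_def)
  then show ?case
  proof cases
    case 1
    then show ?thesis using k by (intro exI[of _ "2 * k"]) auto
  next
    case 2
    then show ?thesis using k by (intro exI[of _ "2 * k + 1"]) (auto simp: field_simps)
  qed
qed simp

text \<open>
  The digits before position \<open>n\<close> give a multiple of \<open>2\<^sup>-\<^sup>n\<close>, those between \<open>n\<close> and \<open>m\<close> vanish, and
  the digits from position \<open>m\<close> on contribute at most \<open>2\<^sup>-\<^sup>m\<close>.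
\<close>
lemma digit_sum_in_grid_nbhd:
  assumes gap: "{n..<m} \<subseteq> G" and "n \<le> m"
  shows "digit_sum (gapped_weight G) x \<in> grid_nbhd n m"
proof -
  define t where "t j = gapped_weight G j * binary_digit j x" for j
  have t0: "0 \<le> t j" for j
    unfolding t_def by (intro mult_nonneg_nonneg gapped_weight_bounds binary_digit_bounds)
  have t1: "t j \<le> (1/2) ^ Suc j" for j
  proof -
    have "t j \<le> (1/2) ^ Suc j * 1"
      unfolding t_def by (intro mult_mono gapped_weight_bounds binary_digit_bounds) simp
    then show ?thesis by simp
  qed
  have sm: "summable t" unfolding t_def by (rule summable_digit_sum[OF summable_gapped_weight])
  have sm': "summable (\<lambda>j. t (j + m))" using sm by (simp add: summable_iff_shift)
  have geo: "(\<lambda>j. (1/2) ^ m * (1/2) ^ Suc j :: real) sums ((1/2) ^ m * 1)"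
    by (rule sums_mult) (rule power_half_series)
  have tail: "(\<Sum>j. t (j + m)) \<le> 1 / 2 ^ m"
  proof -
    have "(\<Sum>j. t (j + m)) \<le> (\<Sum>j. (1/2) ^ m * (1/2) ^ Suc j)"
      using t1[of "_ + m"] by (intro suminf_le sm' sums_summable[OF geo]) (simp add: power_add mult.commute)
    also have "\<dots> = (1/2) ^ m * 1" by (rule sums_unique[OF geo, symmetric])
    finally show ?thesis by (simp add: power_divide)
  qed
  have "(\<Sum>j<m. t j) = (\<Sum>j<n. t j)"
  proof (rule sum.mono_neutral_right)
    show "\<forall>j\<in>{..<m} - {..<n}. t j = 0"
      using gap by (auto simp: t_def gapped_weight_def)
  qed (use \<open>n \<le> m\<close> in auto)
  then have "digit_sum (gapped_weight G) x = (\<Sum>j. t (j + m)) + (\<Sum>j<n. t j)"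
    unfolding digit_sum_def t_def[symmetric] using suminf_split_initial_segment[OF sm, of m] by simp
  moreover obtain k where "k < 2 ^ n" "(\<Sum>j<n. t j) = real k / 2 ^ n"
    using digit_partial_sum_dyadic unfolding t_def by blast
  moreover have "0 \<le> (\<Sum>j. t (j + m))" by (rule suminf_nonneg[OF sm' t0])
  ultimately show ?thesis
    unfolding grid_nbhd_def using tail by (intro UN_I[of k]) auto
qed

lemma measurable_gapped_point [measurable]:
  "(\<lambda>f. \<Sum>i\<in>Basis. digit_sum w (f i) *\<^sub>R i) \<in> Pi\<^sub>M Basis (\<lambda>_. unit_law) \<rightarrow>\<^sub>M (borel :: 'a::euclidean_space measure)"
proof -
  have [measurable]: "digit_sum w \<in> borel_measurable unit_law"
    by (rule measurable_unit_law) measurable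
  show ?thesis by measurable
qed

lemma inner_sum_Basis: "i \<in> Basis \<Longrightarrow> (\<Sum>j\<in>Basis. c j *\<^sub>R j) \<bullet> i = c i"
  by (simp add: inner_sum_left inner_Basis if_distrib sum.If_cases cong: if_cong)

text \<open>
  The complement of the set is open and no point of the cube is mapped into it, so it contains no
  point of the support.
\<close>
lemma gapped_measure_in_measures_on:
  assumes "\<And>k. N k \<le> L k" "\<And>k. {N k..<L k} \<subseteq> G"
  shows "(gapped_measure G :: 'a::euclidean_space measure) \<in> measures_on (grid_set N L)"
proof -
  let ?p = "\<lambda>f. \<Sum>i\<in>Basis. digit_sum (gapped_weight G) (f i) *\<^sub>R (i :: 'a)"
  let ?\<mu> = "gapped_measure G :: 'a measure"
  let ?P = "Pi\<^sub>M (Basis :: 'a set) (\<lambda>_. unit_law)"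
  interpret P: prob_space ?P
    by (intro prob_space_PiM prob_space_unit_law)
  interpret prob_space ?\<mu>
    unfolding gapped_measure_def by (rule P.prob_space_distr) measurable
  have sets: "sets ?\<mu> = sets borel" and space: "space ?\<mu> = UNIV"
    by (simp_all add: gapped_measure_def)
  have "emeasure ?\<mu> UNIV = 1" using emeasure_space_1 space by simp
  moreover have "finite_measure ?\<mu>" by unfold_locales
  moreover have "measure_support ?\<mu> \<subseteq> grid_set N L"
  proof
    fix x assume x: "x \<in> measure_support ?\<mu>"
    show "x \<in> grid_set N L"
    proof (rule ccontr)
      assume "x \<notin> grid_set N L"
      moreover have o: "open (- grid_set N L :: 'a set)" using closed_grid_set by auto
      ultimately have "emeasure ?\<mu> (- grid_set N L) > 0"
        using x unfolding measure_support_def by blast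
      moreover have "emeasure ?\<mu> (- grid_set N L) = emeasure ?P (?p -` (- grid_set N L) \<inter> space ?P)"
        unfolding gapped_measure_def using o by (intro emeasure_distr) auto
      moreover have "?p f \<in> grid_set N L" for f
        unfolding grid_set_def using assms by (auto simp: inner_sum_Basis intro!: digit_sum_in_grid_nbhd)
      then have "?p -` (- grid_set N L) \<inter> space ?P = {}" by auto
      ultimately show False by simp
    qed
  qed
  ultimately show ?thesis
    unfolding measures_on_def using sets by auto
qed

lemma fourier_transform_gapped_measure:
  "fourier_transform (gapped_measure G) z = (\<Prod>i\<in>Basis. digit_char (gapped_weight G) (z \<bullet> i))"
proof -
  let ?w = "gapped_weight G"
  let ?e = "\<lambda>t. exp (- (2 * of_real pi * \<i> * of_real t)) :: complex"
  let ?P = "Pi\<^sub>M (Basis :: 'a set) (\<lambda>_. unit_law)"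
  interpret U: prob_space unit_law by (rule prob_space_unit_law)
  interpret product_sigma_finite "\<lambda>_ :: 'a. unit_law"
    by unfold_locales
  have "fourier_transform (gapped_measure G) z
      = (LINT f|?P. ?e (z \<bullet> (\<Sum>i\<in>Basis. digit_sum ?w (f i) *\<^sub>R i)))"
    unfolding fourier_transform_def gapped_measure_def
    by (rule integral_distr) measurable
  also have "\<dots> = (LINT f|?P. (\<Prod>i\<in>Basis. ?e ((z \<bullet> i) * digit_sum ?w (f i))))"
    by (rule Bochner_Integration.integral_cong)
       (simp_all add: exp_sum[symmetric] inner_sum_right sum_distrib_left sum_negf mult_ac)
  also have "\<dots> = (\<Prod>i\<in>Basis. LINT x|unit_law. ?e ((z \<bullet> i) * digit_sum ?w x))"
    by (intro product_integral_prod integrable_unit_law_bounded[of _ 1]) simp_all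
  finally show ?thesis unfolding digit_char_def .
qed

section \<open>Energy and Fourier spectrum\<close>

text \<open>
  The product bound for the weight fails on the coordinate hyperplanes, where \<open>0 powr v = 0\<close>
  makes its right-hand side vanish.
\<close>
lemma AE_inner_Basis_nonzero: "AE z in lborel. \<forall>i\<in>Basis. (z :: 'a::euclidean_space) \<bullet> i \<noteq> 0"
proof -
  have "AE z in lborel. z \<bullet> i \<noteq> 0" if "i \<in> Basis" for i :: 'a
  proof -
    have "{z. i \<bullet> z = 0} \<in> null_sets lebesgue"
      using that negligible_hyperplane[of i 0] nonzero_Basis[OF that] by (auto simp: negligible_iff_null_sets)
    then have "AE z in lebesgue. z \<notin> {z. i \<bullet> z = 0}" by (rule AE_not_in)
    then show ?thesis by (simp add: AE_completion_iff inner_commute)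
  qed
  then show ?thesis by (intro AE_finite_allI) auto
qed

text \<open>
  Each of the \<open>d\<close> factors \<open>|z|\<^sup>v\<close> is at most \<open>|z\<^sub>i|\<^sup>v\<close>, as \<open>|z\<^sub>i| \<le> |z|\<close> and the exponent is not
  positive.
\<close>
lemma norm_powr_le_prod:
  fixes z :: "'a::euclidean_space"
  assumes "\<And>i. i \<in> Basis \<Longrightarrow> z \<bullet> i \<noteq> 0" "v \<le> 0"
  shows "norm z powr (v * real DIM('a)) \<le> (\<Prod>i\<in>Basis. \<bar>z \<bullet> i\<bar> powr v)"
proof -
  obtain b :: 'a where "b \<in> Basis" using nonempty_Basis by blast
  then have z: "norm z > 0" using assms(1) by fastforce
  have "norm z powr (v * real DIM('a)) = (norm z powr v) ^ DIM('a)"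
    using z by (simp add: powr_powr[symmetric] powr_realpow)
  also have "\<dots> = (\<Prod>i\<in>(Basis :: 'a set). norm z powr v)" by simp
  also have "\<dots> \<le> (\<Prod>i\<in>Basis. \<bar>z \<bullet> i\<bar> powr v)"
    using assms Basis_le_norm by (intro prod_mono conjI powr_mono2') auto
  finally show ?thesis .
qed

lemma gapped_measure_energy_finite:
  assumes gaps: "\<And>n. real (card (G \<inter> {..<n})) \<le> \<rho> * real n"
    and s: "0 < s" "s / real DIM('a) + \<rho> < 1"
  shows "(\<integral>\<^sup>+z. ennreal ((norm (fourier_transform (gapped_measure G) z))\<^sup>2
      * norm z powr (s - real DIM('a))) \<partial>(lborel :: 'a::euclidean_space measure)) < \<infinity>"
proof -
  define u where "u = s / real DIM('a)"
  have u: "0 < u" "u + \<rho> < 1" and su: "s - real DIM('a) = (u - 1) * real DIM('a)"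
    using s by (auto simp: u_def field_simps)
  have "u \<le> 1" using gaps[of 1] u by simp
  let ?D = "\<lambda>t. (norm (digit_char (gapped_weight G) t))\<^sup>2 * \<bar>t\<bar> powr (u - 1)"
  have "(\<integral>\<^sup>+z. ennreal ((norm (fourier_transform (gapped_measure G) z))\<^sup>2
      * norm z powr (s - real DIM('a))) \<partial>(lborel :: 'a measure))
      \<le> (\<integral>\<^sup>+z. (\<Prod>i\<in>Basis. ennreal (?D (z \<bullet> i))) \<partial>(lborel :: 'a measure))"
  proof (rule nn_integral_mono_AE)
    show "AE z in (lborel :: 'a measure). ennreal ((norm (fourier_transform (gapped_measure G) z))\<^sup>2
      * norm z powr (s - real DIM('a))) \<le> (\<Prod>i\<in>Basis. ennreal (?D (z \<bullet> i)))"
      using AE_inner_Basis_nonzero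
    proof eventually_elim
      case (elim z)
      have "(norm (fourier_transform (gapped_measure G) z))\<^sup>2 * norm z powr (s - real DIM('a))
          \<le> (\<Prod>i\<in>Basis. (norm (digit_char (gapped_weight G) (z \<bullet> i)))\<^sup>2) * (\<Prod>i\<in>Basis. \<bar>z \<bullet> i\<bar> powr (u - 1))"
        unfolding fourier_transform_gapped_measure su prod_norm[symmetric] prod_power_distrib
        using elim \<open>u \<le> 1\<close> by (intro mult_left_mono norm_powr_le_prod prod_nonneg) auto
      also have "\<dots> = (\<Prod>i\<in>Basis. ?D (z \<bullet> i))" by (simp add: prod.distrib)
      finally show ?case
        by (subst prod_ennreal) (auto intro: ennreal_leI)
    qed
  qed
  also have "\<dots> = (\<Prod>i\<in>(Basis :: 'a set). \<integral>\<^sup>+t. ennreal (?D t) \<partial>lborel)"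
    by (rule nn_integral_lborel_prod) simp_all
  also have "\<dots> < \<infinity>"
    using digit_char_energy_finite[OF gaps u]
    by (simp add: power_less_top_ennreal)
  finally show ?thesis .
qed

text \<open>
  The \<open>s\<close>-energy dominates the energy integral with parameters \<open>s\<theta>\<close> and \<open>\<theta>\<close>: the weights
  agree, since \<open>s\<theta> / \<theta> - d = s - d\<close>, and a number in \<open>[0,1]\<close> decreases when the exponent grows
  from \<open>2\<close> to \<open>2 / \<theta>\<close>.
\<close>
lemma fourier_spectrum_measure_ge:
  fixes \<mu> :: "'a::euclidean_space measure"
  assumes energy: "(\<integral>\<^sup>+z. ennreal ((norm (fourier_transform \<mu> z))\<^sup>2 * norm z powr (s - real DIM('a))) \<partial>lborel) < \<infinity>"
    and bound: "\<And>z. norm (fourier_transform \<mu> z) \<le> 1"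
    and "0 \<le> s" "0 \<le> \<theta>" "\<theta> \<le> 1"
  shows "ennreal (s * \<theta>) \<le> fourier_spectrum_measure \<theta> \<mu>"
proof (cases "\<theta> = 0")
  case False
  with \<open>0 \<le> \<theta>\<close> have \<theta>: "0 < \<theta>" by simp
  have "(\<integral>\<^sup>+z. ennreal (norm (fourier_transform \<mu> z) powr (2 / \<theta>) * norm z powr (s * \<theta> / \<theta> - real DIM('a))) \<partial>lborel)
      \<le> (\<integral>\<^sup>+z. ennreal ((norm (fourier_transform \<mu> z))\<^sup>2 * norm z powr (s - real DIM('a))) \<partial>lborel)"
  proof (intro nn_integral_mono ennreal_leI mult_mono)
    fix z
    have "norm (fourier_transform \<mu> z) powr (2 / \<theta>) \<le> norm (fourier_transform \<mu> z) powr 2"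
      using bound[of z] \<theta> \<open>\<theta> \<le> 1\<close> by (intro powr_mono') (auto simp: field_simps)
    then show "norm (fourier_transform \<mu> z) powr (2 / \<theta>) \<le> (norm (fourier_transform \<mu> z))\<^sup>2"
      by simp
  qed (use \<theta> in auto)
  then have "fourier_energy (s * \<theta>) \<theta> \<mu> < \<infinity>"
    using energy \<theta> by (auto simp: fourier_energy_def ennreal_powr_def top_unique)
  then show ?thesis
    unfolding fourier_spectrum_measure_def using assms by (intro Sup_upper) auto
qed simp

section \<open>Dimension of the distance set\<close>

text \<open>
  Finite covers by sets of a common size suffice for an upper bound on the dimension. The same
  \<open>\<epsilon>\<close> bounds the size and the total weight, so that one limit over the scales serves both.
\<close>
lemma hausdorff_measure_eq_0I:
  assumes "0 < t"
    and cover: "\<And>\<epsilon>. 0 < \<epsilon> \<Longrightarrow> \<exists>K U r. A \<subseteq> (\<Union>i<K::nat. U i) \<and>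
      (\<forall>i<K. bounded (U i) \<and> diameter (U i) \<le> r) \<and> 0 \<le> r \<and> r \<le> \<epsilon> \<and> real K * r powr t \<le> \<epsilon>"
  shows "hausdorff_measure t A = 0"
proof -
  have "hausdorff_premeasure \<delta> t A = 0" if "0 < \<delta>" for \<delta>
  proof -
    have "hausdorff_premeasure \<delta> t A \<le> 0 + ennreal \<epsilon>" if "0 < \<epsilon>" for \<epsilon>
    proof -
      have "0 < min \<delta> \<epsilon>" using \<open>0 < \<delta>\<close> \<open>0 < \<epsilon>\<close> by simp
      from cover[OF this] obtain K U r where U: "A \<subseteq> (\<Union>i<K::nat. U i)"
        "\<forall>i<K. bounded (U i) \<and> diameter (U i) \<le> r" "0 \<le> r" "r \<le> min \<delta> \<epsilon>" "real K * r powr t \<le> min \<delta> \<epsilon>"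
        by metis
      define V where "V i = (if i < K then U i else {})" for i
      have "hausdorff_premeasure \<delta> t A \<le> (\<Sum>i. hausdorff_weight t (V i))"
        unfolding hausdorff_premeasure_def
        using U \<open>0 < \<delta>\<close> by (intro INF_lower) (fastforce simp: V_def)
      also have "\<dots> = (\<Sum>i<K. hausdorff_weight t (V i))"
        by (rule suminf_finite) (auto simp: V_def hausdorff_weight_def)
      also have "\<dots> \<le> (\<Sum>i<K. ennreal (r powr t))"
      proof (rule sum_mono)
        fix i assume "i \<in> {..<K}"
        then have "diameter (V i) powr t \<le> r powr t"
          using U \<open>0 < t\<close> by (intro powr_mono2 diameter_ge_0) (auto simp: V_def)
        then show "hausdorff_weight t (V i) \<le> ennreal (r powr t)"
          using \<open>0 < t\<close> by (auto simp: hausdorff_weight_def intro: ennreal_leI)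
      qed
      also have "\<dots> = ennreal (real K * r powr t)"
        by (simp add: ennreal_mult ennreal_of_nat_eq_real_of_nat)
      also have "\<dots> \<le> ennreal \<epsilon>" using U by (intro ennreal_leI) simp
      finally show ?thesis by simp
    qed
    then have "hausdorff_premeasure \<delta> t A \<le> 0" by (rule ennreal_le_epsilon)
    then show ?thesis by simp
  qed
  then show ?thesis unfolding hausdorff_measure_def by simp
qed

text \<open>
  The difference of two points near the grid \<open>2\<^sup>-\<^sup>n\<int>\<^sup>d\<close> is near a grid vector, and a grid vector has
  length \<open>\<surd>K / 2\<^sup>n\<close> with \<open>K\<close> a sum of \<open>d\<close> squares of integers of size at most \<open>2\<^sup>n\<close>.
\<close>
lemma dist_near_sqrt_grid:
  fixes x y :: "'a::euclidean_space"
  assumes x: "\<And>i. i \<in> Basis \<Longrightarrow> x \<bullet> i \<in> grid_nbhd n m"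
    and y: "\<And>i. i \<in> Basis \<Longrightarrow> y \<bullet> i \<in> grid_nbhd n m"
  shows "\<exists>K \<le> DIM('a) * 4 ^ n. \<bar>dist x y - sqrt (real K) / 2 ^ n\<bar> \<le> real DIM('a) / 2 ^ m"
proof -
  have "\<forall>i\<in>Basis. \<exists>k\<le>2 ^ n. real k / 2 ^ n \<le> x \<bullet> i \<and> x \<bullet> i \<le> real k / 2 ^ n + 1 / 2 ^ m"
    using x unfolding grid_nbhd_def by auto
  then obtain p where p: "\<And>i. i \<in> Basis \<Longrightarrow> p i \<le> 2 ^ n \<and>
      real (p i) / 2 ^ n \<le> x \<bullet> i \<and> x \<bullet> i \<le> real (p i) / 2 ^ n + 1 / 2 ^ m" by metis
  have "\<forall>i\<in>Basis. \<exists>k\<le>2 ^ n. real k / 2 ^ n \<le> y \<bullet> i \<and> y \<bullet> i \<le> real k / 2 ^ n + 1 / 2 ^ m"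
    using y unfolding grid_nbhd_def by auto
  then obtain q where q: "\<And>i. i \<in> Basis \<Longrightarrow> q i \<le> 2 ^ n \<and>
      real (q i) / 2 ^ n \<le> y \<bullet> i \<and> y \<bullet> i \<le> real (q i) / 2 ^ n + 1 / 2 ^ m" by metis
  define c where "c i = int (p i) - int (q i)" for i
  define v where "v = (\<Sum>i\<in>Basis. (of_int (c i) / 2 ^ n) *\<^sub>R (i :: 'a))"
  define K where "K = (\<Sum>i\<in>(Basis :: 'a set). nat \<bar>c i\<bar> ^ 2)"
  have K: "real K = (\<Sum>i\<in>(Basis :: 'a set). (of_int (c i))\<^sup>2)"
    unfolding K_def by simp
  have "K \<le> (\<Sum>i\<in>(Basis :: 'a set). 4 ^ n)"
    unfolding K_def
  proof (rule sum_mono)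
    fix i :: 'a assume "i \<in> Basis"
    then have "nat \<bar>c i\<bar> \<le> 2 ^ n"
      using p[of i] q[of i] unfolding c_def by linarith
    then have "nat \<bar>c i\<bar> ^ 2 \<le> (2 ^ n) ^ 2" by (rule power_mono) simp
    then show "nat \<bar>c i\<bar> ^ 2 \<le> 4 ^ n" by (simp add: power_even_eq[symmetric] power_mult)
  qed
  then have "K \<le> DIM('a) * 4 ^ n" by simp
  moreover have "norm v = sqrt (real K) / 2 ^ n"
  proof -
    have "norm v = sqrt (\<Sum>i\<in>Basis. (v \<bullet> i)\<^sup>2)"
      by (simp add: norm_eq_sqrt_inner euclidean_inner[of v v] power2_eq_square)
    also have "(\<Sum>i\<in>Basis. (v \<bullet> i)\<^sup>2) = real K / (2 ^ n)\<^sup>2"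
      unfolding v_def K by (simp add: inner_sum_Basis power_divide sum_divide_distrib)
    finally show ?thesis by (simp add: real_sqrt_divide)
  qed
  moreover have "\<bar>norm (x - y) - norm v\<bar> \<le> real DIM('a) / 2 ^ m"
  proof -
    have "\<bar>norm (x - y) - norm v\<bar> \<le> norm (x - y - v)" by (rule norm_triangle_ineq3)
    also have "\<dots> \<le> (\<Sum>i\<in>Basis. \<bar>(x - y - v) \<bullet> i\<bar>)" by (rule norm_le_l1)
    also have "\<dots> \<le> (\<Sum>i\<in>(Basis :: 'a set). 1 / 2 ^ m)"
    proof (rule sum_mono)
      fix i :: 'a assume i: "i \<in> Basis"
      have "(x - y - v) \<bullet> i = (x \<bullet> i - real (p i) / 2 ^ n) - (y \<bullet> i - real (q i) / 2 ^ n)"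
        using i by (simp add: v_def inner_diff_left inner_sum_Basis c_def diff_divide_distrib)
      then show "\<bar>(x - y - v) \<bullet> i\<bar> \<le> 1 / 2 ^ m"
        using p[OF i] q[OF i] by linarith
    qed
    finally show ?thesis by simp
  qed
  ultimately show ?thesis by (auto simp: dist_norm)
qed

text \<open>
  At the scale with \<open>n = bp\<close> and \<open>m = ap\<close> there are \<open>O(4\<^sup>b\<^sup>p)\<close> intervals of length \<open>O(2\<^sup>-\<^sup>a\<^sup>p)\<close>, with
  total \<open>t\<close>-weight \<open>O(2\<^sup>(\<^sup>2\<^sup>b\<^sup>-\<^sup>a\<^sup>t\<^sup>)\<^sup>p)\<close>. This tends to \<open>0\<close> as soon as \<open>t > 2b / a\<close>.
\<close>
lemma hausdorff_dim_distance_set_grid_set_less_1: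
  assumes ab: "2 * b < a" and P: "\<And>p. \<exists>k. p \<le> P k"
  shows "hausdorff_dim (distance_set (grid_set (\<lambda>k. b * P k) (\<lambda>k. a * P k) :: 'a::euclidean_space set)) < 1"
proof -
  let ?A = "distance_set (grid_set (\<lambda>k. b * P k) (\<lambda>k. a * P k) :: 'a set)"
  define d where "d = DIM('a)"
  have d: "d \<ge> 1" unfolding d_def by (simp add: Suc_leI)
  (* the midpoint of 2 b / a and 1 *)
  define t where "t = (real b + real a / 2) / real a"
  have t: "0 < t" "t < 1" and at: "real a * t = real b + real a / 2"
    using ab by (auto simp: t_def field_simps)
  (* the exponent is 2 b - a t *)
  define e where "e = 2 powr (real b - real a / 2)"
  have e: "0 < e" "e < 1"
    using ab powr_less_mono[of "real b - real a / 2" 0 2] by (auto simp: e_def)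
  define C where "C = 2 * real d * (2 * real d) powr t"
  have "hausdorff_measure t ?A = 0"
  proof (rule hausdorff_measure_eq_0I[OF t(1)])
    fix \<epsilon> :: real assume \<epsilon>: "0 < \<epsilon>"
    have "(\<lambda>p. 2 * real d * (1 / 2 ^ a) ^ p) \<longlonglongrightarrow> 2 * real d * 0"
      using ab by (intro tendsto_intros LIMSEQ_realpow_zero) auto
    moreover have "(\<lambda>p. C * e ^ p) \<longlonglongrightarrow> C * 0"
      using e by (intro tendsto_intros LIMSEQ_realpow_zero) auto
    ultimately have "\<forall>\<^sub>F p in sequentially. 2 * real d * (1 / 2 ^ a) ^ p < \<epsilon> \<and> C * e ^ p < \<epsilon>"
      using \<epsilon> by (intro eventually_conj order_tendstoD(2)) auto
    then obtain p0 where p0: "\<And>p. p0 \<le> p \<Longrightarrow> 2 * real d * (1 / 2 ^ a) ^ p < \<epsilon> \<and> C * e ^ p < \<epsilon>"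
      by (auto simp: eventually_sequentially)
    obtain k where k: "p0 \<le> P k" using P by blast
    define n m where "n = b * P k" and "m = a * P k"
    define r where "r = 2 * real d / 2 ^ m"
    define K where "K = Suc (d * 4 ^ n)"
    define U where "U i = {sqrt (real i) / 2 ^ n - real d / 2 ^ m .. sqrt (real i) / 2 ^ n + real d / 2 ^ m}" for i
    have "?A \<subseteq> (\<Union>i<K. U i)"
    proof
      fix \<delta> assume "\<delta> \<in> ?A"
      then obtain x y :: 'a where xy: "\<delta> = dist x y"
        "\<And>i. i \<in> Basis \<Longrightarrow> x \<bullet> i \<in> grid_nbhd n m" "\<And>i. i \<in> Basis \<Longrightarrow> y \<bullet> i \<in> grid_nbhd n m"
        unfolding distance_set_def grid_set_def n_def m_def by blast
      from dist_near_sqrt_grid[OF xy(2,3)] obtain i where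
        "i \<le> d * 4 ^ n" "\<bar>\<delta> - sqrt (real i) / 2 ^ n\<bar> \<le> real d / 2 ^ m"
        unfolding d_def xy(1) by blast
      then show "\<delta> \<in> (\<Union>i<K. U i)"
        unfolding K_def U_def by (intro UN_I[of i]) (auto simp: abs_le_iff)
    qed
    moreover have "bounded (U i) \<and> diameter (U i) \<le> r" for i
      unfolding U_def r_def by (auto simp: diameter_closed_interval)
    moreover have "0 \<le> r" "r \<le> \<epsilon>"
      using p0[OF k] by (auto simp: r_def m_def power_mult power_divide)
    moreover have "real K * r powr t \<le> \<epsilon>"
    proof -
      have "real K \<le> 2 * real d * 4 ^ n"
      proof -
        have "1 * 1 \<le> real d * 4 ^ n" using d by (intro mult_mono) auto
        then show ?thesis by (simp add: K_def)
      qed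
      then have "real K * r powr t \<le> 2 * real d * 4 ^ n * r powr t"
        by (rule mult_right_mono) simp
      also have "\<dots> = C * (4 ^ n / (2 ^ m) powr t)"
        unfolding r_def C_def by (simp add: powr_divide)
      also have "4 ^ n / (2 ^ m) powr t = e ^ P k"
      proof -
        have "(4::real) ^ n = 2 powr (2 * real n)"
          by (simp add: powr_powr[symmetric] powr_realpow)
        moreover have "((2::real) ^ m) powr t = 2 powr (real m * t)"
          by (simp add: powr_realpow[symmetric] powr_powr)
        moreover have "real m * t = real (P k) * (real b + real a / 2)"
          unfolding m_def at[symmetric] by simp
        moreover have "e ^ P k = 2 powr (real (P k) * (real b - real a / 2))"
          unfolding e_def by (simp add: powr_realpow[symmetric] powr_powr mult.commute)
        ultimately show ?thesis
          by (simp add: powr_diff[symmetric] n_def algebra_simps)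
      qed
      also have "C * e ^ P k \<le> \<epsilon>" using p0[OF k] by simp
      finally show ?thesis .
    qed
    ultimately show "\<exists>K U r. ?A \<subseteq> (\<Union>i<K::nat. U i) \<and>
      (\<forall>i<K. bounded (U i) \<and> diameter (U i) \<le> r) \<and> 0 \<le> r \<and> r \<le> \<epsilon> \<and> real K * r powr t \<le> \<epsilon>"
      by blast
  qed
  then have "hausdorff_dim ?A \<le> ennreal t"
    unfolding hausdorff_dim_def using t by (intro Inf_lower) auto
  also have "\<dots> < 1" using t by (simp add: ennreal_less_one_iff)
  finally show ?thesis .
qed

section \<open>Choice of the gaps\<close>

definition geometric_gaps :: "nat \<Rightarrow> nat \<Rightarrow> nat \<Rightarrow> nat set" where
  "geometric_gaps b a M = (\<Union>k. {b * M ^ k..<a * M ^ k})"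

text \<open>
  The density of forbidden digits is largest at the end \<open>aM\<^sup>k\<close> of a gap. There the last gap
  accounts for the proportion \<open>1 - b / a\<close>, and all earlier gaps lie below \<open>aM\<^sup>k\<^sup>-\<^sup>1\<close>, which adds at
  most \<open>1 / M\<close>.
\<close>
lemma card_geometric_gaps_le:
  assumes b: "0 < b" "b < a" and M: "2 \<le> M" "1 / real M \<le> real b / real a"
  shows "real (card (geometric_gaps b a M \<inter> {..<n})) \<le> (1 - real b / real a + 1 / real M) * real n"
proof -
  define \<rho> where "\<rho> = 1 - real b / real a + 1 / real M"
  have \<rho>: "0 \<le> \<rho>" using b by (auto simp: \<rho>_def)
  have grow: "k < M ^ k" for k using M power_gt_expt[of M k] by simp
  show ?thesis
  proof (cases "b < n")
    case False
    have "\<not> j < n" if "b * M ^ k \<le> j" for j k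
    proof -
      have "b * 1 \<le> b * M ^ k" using M by (intro mult_left_mono) auto
      with that False show ?thesis by linarith
    qed
    then have "geometric_gaps b a M \<inter> {..<n} = {}"
      by (auto simp: geometric_gaps_def)
    then show ?thesis using \<rho> by (simp add: \<rho>_def)
  next
    case True
    have bnd: "\<forall>k. b * M ^ k < n \<longrightarrow> k \<le> n"
    proof (intro allI impI)
      fix k assume "b * M ^ k < n"
      moreover have "M ^ k \<le> b * M ^ k" using b by simp
      ultimately show "k \<le> n" using grow[of k] by linarith
    qed
    (* the last gap that begins below n *)
    define k where "k = (GREATEST k. b * M ^ k < n)"
    have k: "b * M ^ k < n" and kmax: "\<And>k'. b * M ^ k' < n \<Longrightarrow> k' \<le> k"
      unfolding k_def using GreatestI_nat[of "\<lambda>k. b * M ^ k < n" 0 n] Greatest_le_nat[of "\<lambda>k. b * M ^ k < n" _ n]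
        bnd True by auto
    define X where "X = M ^ k"
    define c where "c = min n (a * X)"
    have "geometric_gaps b a M \<inter> {..<n} \<subseteq> {..<a * X div M} \<union> {b * X..<c}"
    proof
      fix j assume "j \<in> geometric_gaps b a M \<inter> {..<n}"
      then obtain k' where j: "b * M ^ k' \<le> j" "j < a * M ^ k'" "j < n"
        by (auto simp: geometric_gaps_def)
      then have "k' \<le> k" using kmax by simp
      show "j \<in> {..<a * X div M} \<union> {b * X..<c}"
      proof (cases "k' = k")
        case False
        with \<open>k' \<le> k\<close> have "Suc k' \<le> k" by simp
        then have "M ^ Suc k' \<le> X" unfolding X_def using M by (intro power_increasing) auto
        then have "a * M ^ k' * M \<le> a * X" by (simp add: mult.assoc mult.commute[of _ M])
        then have "a * M ^ k' \<le> a * X div M" using M by (simp add: less_eq_div_iff_mult_less_eq)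
        then show ?thesis using j by simp
      qed (use j in \<open>simp add: X_def c_def\<close>)
    qed
    then have "card (geometric_gaps b a M \<inter> {..<n}) \<le> card ({..<a * X div M} \<union> {b * X..<c})"
      by (intro card_mono) auto
    also have "\<dots> \<le> a * X div M + (c - b * X)"
      using card_Un_le[of "{..<a * X div M}" "{b * X..<c}"] by simp
    finally have "real (card (geometric_gaps b a M \<inter> {..<n})) \<le> real (a * X div M) + real (c - b * X)"
      by linarith
    also have "real (a * X div M) \<le> real (a * X) / real M" by (rule of_nat_div_le_of_nat)
    also have "real (c - b * X) = real c - real b * real X"
    proof -
      have "b * X \<le> c" using k b unfolding c_def X_def by simp
      then show ?thesis by (simp add: of_nat_diff)
    qed
    also have "real (a * X) / real M + (real c - real b * real X)
        = real c - (real b / real a - 1 / real M) * (real a * real X)"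
      using b by (simp add: field_simps)
    also have "\<dots> \<le> real c - (real b / real a - 1 / real M) * real c"
    proof -
      have "real c \<le> real a * real X" unfolding c_def by (simp flip: of_nat_mult)
      then show ?thesis using M by (intro diff_left_mono mult_left_mono) auto
    qed
    also have "\<dots> = \<rho> * real c" by (simp add: \<rho>_def algebra_simps)
    also have "\<dots> \<le> \<rho> * real n" using \<rho> by (intro mult_left_mono) (auto simp: c_def)
    finally show ?thesis unfolding \<rho>_def by simp
  qed
qed

theorem proposition3p3:
  fixes s :: real
  assumes "CARD('n::finite) \<ge> 2"
    and "0 < s" and "s < real CARD('n) / 2"
  shows "\<exists>E :: (real ^ 'n) set. E \<in> sets borel \<and>
           hausdorff_dim (distance_set E) < 1 \<and>
           (\<forall>\<theta>\<in>{0..1}. fourier_spectrum \<theta> E \<ge> ennreal (s * \<theta>))"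
proof -
  define d where "d = real CARD('n)"
  define u where "u = s / d"
  have d: "0 < d" by (simp add: d_def)
  then have u: "0 < u" "u < 1 / 2" using assms by (auto simp: u_def d_def field_simps)
  (* r = b / a is the ratio n / m of the scales: below 1 / 2 for the distance set, above s / d for
     the energy; 1 / M must fit into the room between s / d and r *)
  obtain r where r: "r \<in> \<rat>" "u < r" "r < 1 / 2" using Rats_dense_in_real[OF u(2)] by blast
  obtain b a :: nat where ba: "a \<noteq> 0" "\<bar>r\<bar> = real b / real a" using Rats_abs_nat_div_natE[OF r(1)] by metis
  have r_eq: "r = real b / real a" using ba r u by simp
  have "b \<noteq> 0" using r u r_eq by (intro notI) simp
  moreover have "2 * b < a"
  proof -
    have "real (2 * b) < real a" using r ba unfolding r_eq by (simp add: field_simps)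
    then show ?thesis by linarith
  qed
  ultimately have ab: "0 < b" "2 * b < a" "b < a" by auto
  obtain M :: nat where "M \<noteq> 0" and M: "1 / real M < r - u"
    using r real_arch_inverse[of "r - u"] by (auto simp: inverse_eq_divide)
  have M2: "2 \<le> M"
  proof (rule ccontr)
    assume "\<not> 2 \<le> M"
    then have "M = 1" using \<open>M \<noteq> 0\<close> by linarith
    then show False using M r u by simp
  qed
  define \<rho> where "\<rho> = 1 - real b / real a + 1 / real M"
  define G where "G = geometric_gaps b a M"
  define E :: "(real ^ 'n) set" where "E = grid_set (\<lambda>k. b * M ^ k) (\<lambda>k. a * M ^ k)"
  let ?\<mu> = "gapped_measure G :: (real ^ 'n) measure"
  have gaps: "real (card (G \<inter> {..<n})) \<le> \<rho> * real n" for n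
    unfolding G_def \<rho>_def using M r u ab M2 by (intro card_geometric_gaps_le) (auto simp: r_eq[symmetric])
  have "?\<mu> \<in> measures_on E"
    unfolding E_def
  proof (rule gapped_measure_in_measures_on)
    show "b * M ^ k \<le> a * M ^ k" for k using ab by simp
    show "{b * M ^ k..<a * M ^ k} \<subseteq> G" for k unfolding G_def geometric_gaps_def by blast
  qed
  have bound: "norm (fourier_transform ?\<mu> z) \<le> 1" for z
    unfolding fourier_transform_gapped_measure prod_norm[symmetric]
    by (intro prod_le_1 conjI norm_ge_zero norm_digit_char_le_1)
  have energy: "(\<integral>\<^sup>+z. ennreal ((norm (fourier_transform ?\<mu> z))\<^sup>2
      * norm z powr (s - real DIM(real ^ 'n))) \<partial>lborel) < \<infinity>"
  proof (rule gapped_measure_energy_finite[OF gaps])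
    show "s / real DIM(real ^ 'n) + \<rho> < 1" using M by (simp add: \<rho>_def r_eq u_def d_def)
  qed (rule assms)
  have "ennreal (s * \<theta>) \<le> fourier_spectrum \<theta> E" if \<theta>: "\<theta> \<in> {0..1}" for \<theta>
  proof -
    have "ennreal (s * \<theta>) \<le> fourier_spectrum_measure \<theta> ?\<mu>"
      using \<theta> assms by (intro fourier_spectrum_measure_ge[OF energy bound]) auto
    moreover have "ennreal (s * \<theta>) \<le> of_nat DIM(real ^ 'n)"
    proof -
      have "s * \<theta> \<le> s * 1" using \<theta> assms by (intro mult_left_mono) auto
      moreover have "s \<le> real DIM(real ^ 'n)" using assms by simp
      ultimately have "s * \<theta> \<le> real DIM(real ^ 'n)" by linarith
      then show ?thesis by (simp add: ennreal_of_nat_eq_real_of_nat ennreal_leI)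
    qed
    ultimately show ?thesis
      unfolding fourier_spectrum_def using \<open>?\<mu> \<in> measures_on E\<close>
      by (intro SUP_upper2[of ?\<mu>]) simp_all
  qed
  moreover have "hausdorff_dim (distance_set E) < 1"
    unfolding E_def
  proof (rule hausdorff_dim_distance_set_grid_set_less_1[OF ab(2)])
    show "\<exists>k. p \<le> M ^ k" for p
      using power_gt_expt[of M p] M2 by (intro exI[of _ p]) simp
  qed
  moreover have "E \<in> sets borel"
    unfolding E_def using closed_grid_set by (rule borel_closed)
  ultimately show ?thesis by blast
qed

end
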